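(* There exist (uncolored, hence in particular colored) multiset Eulerian polynomials that are not $s$-Eulerian: there exist $n\ge1$ and $\mathbf{m}\in\mathbb{Z}_{>0}^n$ such that, with $\mathbf{1}=(1,\dots,1)\in\mathbb{Z}^n$, the polynomial $A_{\mathbf{m}}^{\mathbf{1}}$ is not equal to $E_N^s$ for any integer $N\ge1$ and any sequence of positive integers $s=(s_1,s_2,\dots)$.
   Context: For $\mathbf{m}=(m_1,\dots,m_n)$ a vector of positive integers with $m=m_1+\cdots+m_n$, the multiset Eulerian polynomial is $A_{\mathbf{m}}^{\mathbf{1}}=\sum_{\pi}x^{\mathrm{des}(\pi)}$, the sum over all words $\pi=\pi_1\cdots\pi_m$ in which each $k\in\{1,\dots,n\}$ appears exactly $m_k$ times, where $\mathrm{des}(\pi)=|\{j\in\{1,\dots,m-1\}:\pi_j>\pi_{j+1}\}|$. (This is the case of all color bounds equal to $1$ of the colored multiset Eulerian polynomials $A_{\mathbf{m}}^{\mathbf{r}}$.) For a sequence of positive integers $s=(s_1,s_2,\dots)$ and $N\ge1$, the $s$-Eulerian polynomial is $E_N^s=\sum_{e}x^{\mathrm{asc}(e)}$ over all $e\in\mathbb{Z}^N$ with $0\le e_i\le s_i-1$ for all $i$, where $\mathrm{asc}(e)=|\{i\in\{0,\dots,N-1\}:e_i/s_i<e_{i+1}/s_{i+1}\}|$ with $e_0:=0$, $s_0:=1$. (Equivalently, it is the Ehrhart $h^*$-polynomial of the simplex $\{x\in\mathbb{R}^N:0\le x_1/s_1\le\cdots\le x_N/s_N\le1\}$.) A polynomial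 is $s$-Eulerian if it equals $E_N^s$ for some $N$ and $s$. *)

theory Defs
  imports Complex_Main "HOL-Library.FuncSet" "HOL-Computational_Algebra.Polynomial"
begin

text \<open>A vector \<open>(m\<^sub>1, \<dots>, m\<^sub>n)\<close> is a function on \<open>nat\<close> of which only the values on
  \<open>{1..n}\<close> are used. Words are lists, so the letter \<open>\<pi>\<^sub>j\<close> is \<open>w ! (j - 1)\<close>.\<close>

definition multiset_words :: "nat \<Rightarrow> (nat \<Rightarrow> nat) \<Rightarrow> nat list set" where
  "multiset_words n m = {w. set w \<subseteq> {1..n} \<and> (\<forall>k\<in>{1..n}. count_list w k = m k)}"

definition des :: "nat list \<Rightarrow> nat" where
  "des w = card {j \<in> {1..length w - 1}. w ! (j - 1) > w ! j}"

definition multiset_Eulerian :: "nat \<Rightarrow> (nat \<Rightarrow> nat) \<Rightarrow> int poly" where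
  "multiset_Eulerian n m = (\<Sum>w\<in>multiset_words n m. monom 1 (des w))"

text \<open>The integer vectors \<open>(e\<^sub>1, \<dots>, e\<^sub>N)\<close> are extensional functions on \<open>{1..N}\<close>, so each
  vector is counted once. The values of \<open>e\<close> and \<open>s\<close> at \<open>0\<close> are overridden by the
  conventions \<open>e\<^sub>0 = 0\<close> and \<open>s\<^sub>0 = 1\<close>.\<close>

definition inversion_seqs :: "nat \<Rightarrow> (nat \<Rightarrow> nat) \<Rightarrow> (nat \<Rightarrow> int) set" where
  "inversion_seqs N s = (\<Pi>\<^sub>E i\<in>{1..N}. {0..int (s i) - 1})"

definition asc :: "nat \<Rightarrow> (nat \<Rightarrow> nat) \<Rightarrow> (nat \<Rightarrow> int) \<Rightarrow> nat" where
  "asc N s e = (let e' = e(0 := 0); s' = s(0 := 1) in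
     card {i \<in> {0..<N}.
       rat_of_int (e' i) / rat_of_nat (s' i) <
       rat_of_int (e' (i + 1)) / rat_of_nat (s' (i + 1))})"

definition s_Eulerian :: "nat \<Rightarrow> (nat \<Rightarrow> nat) \<Rightarrow> int poly" where
  "s_Eulerian N s = (\<Sum>e\<in>inversion_seqs N s. monom 1 (asc N s e))"

text \<open>Both index sets are finite, so the sums above do not degenerate to \<open>0\<close>.\<close>

lemma finite_multiset_words: "finite (multiset_words n m)"
proof (rule finite_subset)
  show "multiset_words n m \<subseteq> {w. set w \<subseteq> {1..n} \<and> length w = (\<Sum>k\<in>{1..n}. m k)}"
  proof
    fix w assume w: "w \<in> multiset_words n m"
    then have "length w = (\<Sum>k\<in>{1..n}. count_list w k)"
      unfolding multiset_words_def
      by (metis (mono_tags, lifting) mem_Collect_eq finite_atLeastAtMost sum_count_set)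
    also have "\<dots> = (\<Sum>k\<in>{1..n}. m k)"
      using w by (intro sum.cong) (auto simp: multiset_words_def)
    finally show "w \<in> {w. set w \<subseteq> {1..n} \<and> length w = (\<Sum>k\<in>{1..n}. m k)}"
      using w by (simp add: multiset_words_def)
  qed
qed (rule finite_lists_length_eq, simp)

lemma finite_inversion_seqs: "finite (inversion_seqs N s)"
  unfolding inversion_seqs_def by (rule finite_PiE) auto

end

theory Submission
  imports Defs
begin

text \<open>The witness is \<open>m = (3, 2)\<close>, for which the polynomial is \<open>1 + 6x + 3x\<^sup>2\<close>. Its value at
  \<open>1\<close> is \<open>10\<close>, and the value of \<open>E\<^sub>N\<^sup>s\<close> at \<open>1\<close> is the product of the \<open>s\<^sub>i\<close>, so apart from entries
  equal to \<open>1\<close> the sequence \<open>s\<close> consists either of a single \<open>10\<close> or of a \<open>2\<close> and a \<open>5\<close>. Ascents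
  only occur at entries different from \<open>1\<close>, so in the first case the degree is at most \<open>1\<close>. In the
  second case the coefficient of \<open>x\<^sup>2\<close> is \<open>2\<close> or \<open>4\<close>, depending on whether the two entries are
  adjacent.\<close>

section \<open>Descents and the polynomial of the multiset with three 1s and two 2s\<close>

lemma des_Nil [simp]: "des [] = 0"
  and des_singleton [simp]: "des [x] = 0"
  by (simp_all add: des_def)

text \<open>Recursion for evaluating \<open>des\<close> on explicit words: index 1 compares
  \<open>x\<close> with \<open>y\<close>, and every later index is the successor of an index for
  \<open>y # w\<close>.\<close>

lemma des_Cons_Cons [simp]: "des (x # y # w) = (if y < x then 1 else 0) + des (y # w)"
proof -
  have "{j \<in> {1..length (x # y # w) - 1}. (x # y # w) ! (j - 1) > (x # y # w) ! j}
     = (if y < x then {1} else {}) \<union>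
       Suc ` {j \<in> {1..length (y # w) - 1}. (y # w) ! (j - 1) > (y # w) ! j}"
    (is "?L = ?I \<union> Suc ` ?R")
  proof (rule set_eqI)
    fix j
    show "j \<in> ?L \<longleftrightarrow> j \<in> ?I \<union> Suc ` ?R"
    proof (cases "j \<le> 1")
      case True
      then show ?thesis by (cases j) auto
    next
      case False
      then obtain i where "j = Suc (Suc i)"
        by (metis One_nat_def not0_implies_Suc le_SucI le_refl zero_le)
      then show ?thesis by (auto simp: image_iff)
    qed
  qed
  moreover have "card (?I \<union> Suc ` ?R) = card ?I + card (Suc ` ?R)"
    by (rule card_Un_disjoint) auto
  ultimately show ?thesis
    by (simp add: des_def card_image)
qed

text \<open>With only two letters the counts fix the length, so the words can be found by filtering
  a finite explicit list.\<close>

lemma multiset_words_two: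
  "multiset_words 2 m = {w \<in> set (List.n_lists (m 1 + m 2) [1, 2]).
     count_list w 1 = m 1 \<and> count_list w 2 = m 2}"
proof -
  have len: "length w = count_list w 1 + count_list w 2" if "set w \<subseteq> {1, 2}" for w :: "nat list"
    using that by (induction w) auto
  have "{1..2} = {1, 2 :: nat}" by auto
  with len show ?thesis
    by (auto simp: multiset_words_def set_n_lists)
qed

lemma multiset_Eulerian_3_2:
  "multiset_Eulerian 2 (\<lambda>k. if k = 1 then 3 else 2) = [:1, 6, 3:]"
proof -
  have "multiset_words 2 (\<lambda>k. if k = 1 then 3 else 2) =
    set (filter (\<lambda>w. count_list w 1 = 3 \<and> count_list w 2 = 2) (List.n_lists 5 [1, 2]))"
    by (simp add: multiset_words_two)
  also have "\<dots> = {[1,1,1,2,2], [1,1,2,1,2], [1,1,2,2,1], [1,2,1,1,2], [1,2,1,2,1], [1,2,2,1,1],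
     [2,1,1,1,2], [2,1,1,2,1], [2,1,2,1,1], [2,2,1,1,1]}"
    by (simp add: eval_nat_numeral insert_commute)
  \<comment> \<open>Of these ten words one has no descent, six have one and three have two.\<close>
  finally show ?thesis
    by (simp add: multiset_Eulerian_def monom_altdef eval_nat_numeral one_pCons)
qed

section \<open>Ascents and the quadratic coefficient of s-Eulerian polynomials\<close>

lemma coeff_s_Eulerian:
  "coeff (s_Eulerian N s) k = int (card {e \<in> inversion_seqs N s. asc N s e = k})"
proof -
  have "coeff (s_Eulerian N s) k =
    (\<Sum>e\<in>inversion_seqs N s. if asc N s e = k then 1 else 0)"
    by (simp add: s_Eulerian_def coeff_sum coeff_monom)
  also have "\<dots> = int (card {e \<in> inversion_seqs N s. asc N s e = k})"
    by (simp add: sum.If_cases finite_inversion_seqs Int_def)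
  finally show ?thesis .
qed

lemma poly_s_Eulerian_1: "poly (s_Eulerian N s) 1 = int (\<Prod>i\<in>{1..N}. s i)"
  by (simp add: s_Eulerian_def poly_sum poly_monom inversion_seqs_def card_PiE)

text \<open>The ascent condition with denominators cleared, indexed by the right end of the ascent.
  The case \<open>i = 1\<close> builds in the conventions for \<open>e\<close> and \<open>s\<close>
  at 0.\<close>

definition ascent_at :: "(nat \<Rightarrow> nat) \<Rightarrow> (nat \<Rightarrow> int) \<Rightarrow> nat \<Rightarrow> bool" where
  "ascent_at s e i \<longleftrightarrow> (if i = 1 then 0 < e i else e (i - 1) * int (s i) < e i * int (s (i - 1)))"

lemma ratio_less_iff:
  assumes "0 < b" "0 < d"
  shows "rat_of_int a / rat_of_nat b < rat_of_int c / rat_of_nat d \<longleftrightarrow> a * int d < c * int b"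
proof -
  have "rat_of_int a / rat_of_nat b < rat_of_int c / rat_of_nat d \<longleftrightarrow>
    rat_of_int (a * int d) < rat_of_int (c * int b)"
    using assms by (simp add: field_simps)
  then show ?thesis by (simp only: of_int_less_iff)
qed

text \<open>Where \<open>s i = 1\<close> the entry \<open>e i\<close> is 0, and an ascent to 0 would
  need a negative predecessor.\<close>

lemma asc_eq_card_ascent_at:
  assumes s: "\<forall>i\<ge>1. s i > 0" and e: "e \<in> inversion_seqs N s"
  shows "asc N s e = card {i \<in> {1..N}. s i \<noteq> 1 \<and> ascent_at s e i}"
proof -
  have "\<not> ascent_at s e i" if "i \<in> {1..N}" "s i = 1" for i
  proof -
    have "e i = 0"
      using that e by (fastforce simp: inversion_seqs_def PiE_def Pi_def)
    \<comment> \<open>For \<open>i = 1\<close> the predecessor \<open>e 0\<close> lies outside the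
      domain of the extensional function \<open>e\<close>, so nothing is known about it.\<close>
    moreover have "0 \<le> e (i - 1)" if "i \<noteq> 1"
    proof -
      have "i - 1 \<in> {1..N}"
        using that \<open>i \<in> {1..N}\<close> by auto
      then show ?thesis
        using e by (fastforce simp: inversion_seqs_def PiE_def Pi_def)
    qed
    ultimately show ?thesis
      using \<open>s i = 1\<close> by (auto simp: ascent_at_def)
  qed
  then have "{i \<in> {1..N}. s i \<noteq> 1 \<and> ascent_at s e i} = {i \<in> {1..N}. ascent_at s e i}"
    by auto
  \<comment> \<open>Shift from right ends in \<open>{1..N}\<close> to left ends in
    \<open>{0..<N}\<close>, as in \<open>asc\<close>.\<close>
  also have "\<dots> = Suc ` {i \<in> {0..<N}. ascent_at s e (Suc i)}"
    by (auto simp: image_iff Suc_le_eq gr0_conv_Suc)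
  also have "card \<dots> = card {i \<in> {0..<N}. ascent_at s e (Suc i)}"
    by (simp add: card_image)
  also have "{i \<in> {0..<N}. ascent_at s e (Suc i)} = {i \<in> {0..<N}.
       rat_of_int ((e(0 := 0)) i) / rat_of_nat ((s(0 := 1)) i) <
       rat_of_int ((e(0 := 0)) (i + 1)) / rat_of_nat ((s(0 := 1)) (i + 1))}"
    using s by (subst ratio_less_iff) (auto simp: ascent_at_def)
  finally show ?thesis
    by (simp add: asc_def Let_def)
qed

text \<open>If the two nontrivial entries are not adjacent, then the letter before \<open>e\<^sub>q\<close> is \<open>0\<close>, whence
  the case distinction.\<close>

lemma coeff_2_s_Eulerian_two_entries:
  assumes s: "\<forall>i\<ge>1. s i > 0" and nontrivial: "{i \<in> {1..N}. s i \<noteq> 1} = {p, q}" and "p < q"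
  shows "coeff (s_Eulerian N s) 2 = int (card {(a, b) \<in> {0..int (s p) - 1} \<times> {0..int (s q) - 1}.
    0 < a \<and> (if q = Suc p then a * int (s q) < b * int (s p) else 0 < b)})"
    (is "_ = int (card ?B)")
proof -
  have "p \<in> {i \<in> {1..N}. s i \<noteq> 1}" "q \<in> {i \<in> {1..N}. s i \<noteq> 1}"
    unfolding nontrivial by auto
  then have pq: "1 \<le> p" "q \<le> N"
    by auto
  have triv: "s i = 1" if "i \<in> {1..N}" "i \<noteq> p" "i \<noteq> q" for i
    using nontrivial that by blast
  let ?A = "{e \<in> inversion_seqs N s. asc N s e = 2}"
  have mem: "e i \<in> {0..int (s i) - 1}" if "e \<in> inversion_seqs N s" "i \<in> {1..N}" for e i
    using that unfolding inversion_seqs_def by (rule PiE_mem)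
  have zero: "e i = 0" if "e \<in> inversion_seqs N s" "i \<in> {1..N}" "i \<noteq> p" "i \<noteq> q" for e i
    using mem[OF that(1,2)] triv[OF that(2-)] by simp
  have asc2: "asc N s e = 2 \<longleftrightarrow>
      0 < e p \<and> (if q = Suc p then e p * int (s q) < e q * int (s p) else 0 < e q)"
    if e: "e \<in> inversion_seqs N s" for e
  proof -
    have "{i \<in> {1..N}. s i \<noteq> 1 \<and> ascent_at s e i} = {i \<in> {p, q}. ascent_at s e i}"
      using nontrivial by blast
    then have "asc N s e = card {i \<in> {p, q}. ascent_at s e i}"
      using asc_eq_card_ascent_at[OF s e] by simp
    also have "{i \<in> {p, q}. ascent_at s e i} =
        (if ascent_at s e p then {p} else {}) \<union> (if ascent_at s e q then {q} else {})"
      by auto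
    also have "card \<dots> = 2 \<longleftrightarrow> ascent_at s e p \<and> ascent_at s e q"
      using \<open>p < q\<close> by auto
    \<comment> \<open>The value before \<open>e p\<close> counts as 0: by convention if
      \<open>p = 1\<close>, and otherwise because \<open>s (p - 1) = 1\<close>.\<close>
    also have "ascent_at s e p \<longleftrightarrow> 0 < e p"
    proof (cases "p = 1")
      case False
      then have "p - 1 \<in> {1..N}" "p - 1 \<noteq> p" "p - 1 \<noteq> q"
        using pq \<open>p < q\<close> by auto
      then show ?thesis
        using False zero[OF e] triv by (simp add: ascent_at_def)
    qed (simp add: ascent_at_def)
    also have "ascent_at s e q \<longleftrightarrow>
        (if q = Suc p then e p * int (s q) < e q * int (s p) else 0 < e q)"
    proof (cases "q = Suc p")
      case True
      then show ?thesis using pq by (simp add: ascent_at_def)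
    next
      case False
      then have "q - 1 \<in> {1..N}" "q - 1 \<noteq> p" "q - 1 \<noteq> q" "q \<noteq> 1"
        using pq \<open>p < q\<close> by auto
      then show ?thesis
        using False zero[OF e] triv by (simp add: ascent_at_def)
    qed
    finally show ?thesis .
  qed
  \<comment> \<open>All entries other than \<open>e p\<close> and \<open>e q\<close> are forced to
    be 0, so this pair determines \<open>e\<close>.\<close>
  have "bij_betw (\<lambda>e. (e p, e q)) ?A ?B"
  proof (rule bij_betw_imageI)
    show "inj_on (\<lambda>e. (e p, e q)) ?A"
    proof (rule inj_onI)
      fix e e' assume e: "e \<in> ?A" "e' \<in> ?A" and eq: "(e p, e q) = (e' p, e' q)"
      then have "e \<in> inversion_seqs N s" "e' \<in> inversion_seqs N s" by auto
      moreover have "e i = e' i" if "i \<in> {1..N}" for i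
        using calculation[THEN zero, OF that] eq by (cases "i = p"; cases "i = q") auto
      ultimately show "e = e'"
        unfolding inversion_seqs_def by (rule PiE_ext)
    qed
    show "(\<lambda>e. (e p, e q)) ` ?A = ?B"
    proof
      show "(\<lambda>e. (e p, e q)) ` ?A \<subseteq> ?B"
        using asc2 mem[of _ p] mem[of _ q] pq \<open>p < q\<close> by fastforce
      show "?B \<subseteq> (\<lambda>e. (e p, e q)) ` ?A"
      proof clarify
        fix a b
        assume ab: "a \<in> {0..int (s p) - 1}" "b \<in> {0..int (s q) - 1}" "0 < a"
          "if q = Suc p then a * int (s q) < b * int (s p) else 0 < b"
        define e where "e = (\<lambda>i\<in>{1..N}. if i = p then a else if i = q then b else 0)"
        have "e p = a" "e q = b"
          using pq \<open>p < q\<close> by (auto simp: e_def)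
        moreover have e: "e \<in> inversion_seqs N s"
          unfolding inversion_seqs_def e_def using ab triv
          by (intro restrict_PiE_iff[THEN iffD2]) auto
        ultimately show "(a, b) \<in> (\<lambda>e. (e p, e q)) ` ?A"
          using asc2[OF e] ab by (intro image_eqI[of _ _ e]) auto
      qed
    qed
  qed
  then show ?thesis
    by (simp add: coeff_s_Eulerian bij_betw_same_card)
qed

text \<open>Both orders of the entries give the same counts. If they are adjacent, 5 < 2b leaves b =
  3, 4 and 2a < 5 leaves a = 1, 2; otherwise all four pairs of positive values count.\<close>

lemma coeff_2_s_Eulerian_2_5:
  assumes s: "\<forall>i\<ge>1. s i > 0" and nontrivial: "{i \<in> {1..N}. s i \<noteq> 1} = {p, q}"
    and sp: "s p = 2" and sq: "s q = 5"
  shows "coeff (s_Eulerian N s) 2 \<in> {2, 4}"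
proof -
  have r2: "{0..1} = {0, 1 :: int}" and r5: "{0..4} = {0, 1, 2, 3, 4 :: int}"
    by auto
  \<comment> \<open>\<open>p\<close> and \<open>q\<close> differ because \<open>s\<close> takes
    different values there.\<close>
  consider "p < q" | "q < p"
    using sp sq by (metis linorder_neqE_nat numeral_eq_iff semiring_norm(88,89) verit_eq_simplify(12))
  then show ?thesis
  proof cases
    case 1
    have "{(a, b) \<in> {0..int (s p) - 1} \<times> {0..int (s q) - 1}.
        0 < a \<and> (if q = Suc p then a * int (s q) < b * int (s p) else 0 < b)} =
      (if q = Suc p then {(1, 3), (1, 4)} else {(1, 1), (1, 2), (1, 3), (1, 4)})"
      using sp sq by (auto simp: r2 r5)
    then show ?thesis
      using coeff_2_s_Eulerian_two_entries[OF s nontrivial 1] by simp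
  next
    case 2
    have "{(a, b) \<in> {0..int (s q) - 1} \<times> {0..int (s p) - 1}.
        0 < a \<and> (if p = Suc q then a * int (s p) < b * int (s q) else 0 < b)} =
      (if p = Suc q then {(1, 1), (2, 1)} else {(1, 1), (2, 1), (3, 1), (4, 1)})"
      using sp sq by (auto simp: r2 r5)
    then show ?thesis
      using coeff_2_s_Eulerian_two_entries[OF s _ 2] nontrivial by (simp add: insert_commute)
  qed
qed

lemma coeff_2_s_Eulerian_one_entry:
  assumes s: "\<forall>i\<ge>1. s i > 0" and nontrivial: "{i \<in> {1..N}. s i \<noteq> 1} \<subseteq> {p}"
  shows "coeff (s_Eulerian N s) 2 = 0"
proof -
  have "asc N s e \<le> 1" if "e \<in> inversion_seqs N s" for e
  proof -
    have "card {i \<in> {1..N}. s i \<noteq> 1 \<and> ascent_at s e i} \<le> card {p}"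
      using nontrivial by (intro card_mono) auto
    then show ?thesis
      using asc_eq_card_ascent_at[OF s that] by simp
  qed
  then have "{e \<in> inversion_seqs N s. asc N s e = 2} = {}"
    by force
  then show ?thesis
    by (simp only: coeff_s_Eulerian card.empty of_nat_0)
qed

section \<open>Factorizations of 10 and the contradiction\<close>

text \<open>Each of the primes 2 and 5 divides some factor. The cases are whether one factor serves
  for both; in either case the remaining factors multiply to 1.\<close>

lemma prod_eq_10_cases:
  fixes s :: "nat \<Rightarrow> nat"
  assumes "finite A" and prod: "prod s A = 10"
  obtains p where "{i \<in> A. s i \<noteq> 1} \<subseteq> {p}"
    | p q where "{i \<in> A. s i \<noteq> 1} = {p, q}" "s p = 2" "s q = 5"
proof -
  have "prime (2 :: nat)" "prime (5 :: nat)"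
    by simp_all
  moreover have "2 dvd prod s A" "5 dvd prod s A"
    by (simp_all add: prod)
  ultimately obtain p q where p: "p \<in> A" "2 dvd s p" and q: "q \<in> A" "5 dvd s q"
    using prime_dvd_prod_iff[OF \<open>finite A\<close>] by metis
  show thesis
  proof (cases "p = q")
    case True
    then have "10 dvd s p"
      using p q by presburger
    moreover have "s p * prod s (A - {p}) = 10"
      using prod p prod.remove[OF \<open>finite A\<close>] by metis
    ultimately have "prod s (A - {p}) = 1"
      by (auto elim!: dvdE)
    then have "\<forall>i\<in>A - {p}. s i = 1"
      using \<open>finite A\<close> by (subst (asm) prod_eq_1_iff) auto
    then show thesis
      by (intro that(1)[of p]) auto
  next
    case False
    have "s p * (s q * prod s (A - {p} - {q})) = 10"
      using prod p q False prod.remove[of A p s] prod.remove[of "A - {p}" q s] \<open>finite A\<close> by simp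
    moreover obtain k l where kl: "s p = 2 * k" "s q = 5 * l"
      using p q by (auto elim!: dvdE)
    \<comment> \<open>Cancelling 10 leaves a product of naturals equal to 1, so each factor is
      1.\<close>
    ultimately have "k * (l * prod s (A - {p} - {q})) = 1"
      by simp
    then have "k = 1" "l = 1" "prod s (A - {p} - {q}) = 1"
      by (simp_all only: nat_mult_eq_1_iff)
    then have "\<forall>i\<in>A - {p} - {q}. s i = 1"
      using \<open>finite A\<close> by (subst (asm) prod_eq_1_iff) auto
    then show thesis
      using p q kl \<open>k = 1\<close> \<open>l = 1\<close> by (intro that(2)[of p q]) auto
  qed
qed

theorem proposition25:
  shows "\<exists>(n::nat) (m :: nat \<Rightarrow> nat). n \<ge> 1 \<and> (\<forall>k\<in>{1..n}. m k > 0) \<and>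
    (\<forall>(N::nat) (s :: nat \<Rightarrow> nat). N \<ge> 1 \<longrightarrow> (\<forall>i\<ge>1. s i > 0) \<longrightarrow>
      multiset_Eulerian n m \<noteq> s_Eulerian N s)"
proof -
  have "s_Eulerian N s \<noteq> [:1, 6, 3:]" if s: "\<forall>i\<ge>1. s i > 0" for N s
  proof
    assume E: "s_Eulerian N s = [:1, 6, 3:]"
    then have "int (\<Prod>i\<in>{1..N}. s i) = 10"
      using poly_s_Eulerian_1[of N s] by simp
    then have "(\<Prod>i\<in>{1..N}. s i) = 10"
      by linarith
    \<comment> \<open>The required coefficient 3 is not among these values.\<close>
    then have "coeff (s_Eulerian N s) 2 \<in> {0, 2, 4}"
      using coeff_2_s_Eulerian_one_entry[OF s] coeff_2_s_Eulerian_2_5[OF s]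
      by (elim prod_eq_10_cases[rotated]) auto
    then show False
      by (simp add: E eval_nat_numeral)
  qed
  then show ?thesis
    by (intro exI[of _ 2] exI[of _ "\<lambda>k. if k = 1 then 3 else 2"])
      (auto simp: multiset_Eulerian_3_2[simplified] dest: sym)
qed

end
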